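(* Let $X$ be an Archimedean pervasive pre-Riesz space and let $a\in X$ be an atom. Then the principal ideal and the principal band generated by $a$ coincide, i.e. $\mathcal I_a=\mathcal B_a$.
   Context: All vector spaces are real. An ordered vector space $X$ is a real vector space with a cone $X_+$ (closed under addition and multiplication by nonnegative scalars, $X_+\cap(-X_+)=\{0\}$), ordered by $x\le y$ iff $y-x\in X_+$. It is Archimedean if $nx\le y$ for all $n\in\mathbb N$ implies $x\le 0$. A linear subspace $D$ of an ordered vector space $Y$ is order dense in $Y$ if $y=\inf\{z\in D: y\le z\}$ for every $y\in Y$. An ordered vector space $X$ is a pre-Riesz space if there exist a vector lattice $Y$ and a bipositive linear map $i\colon X\to Y$ (i.e. $i(x)\ge 0$ iff $x\ge 0$) such that $i(X)$ is order dense in $Y$; then $(Y,i)$ is called a vector lattice cover of $X$. A pre-Riesz space $X$ is pervasive if for some (equivalently, every) vector lattice cover $(Y,i)$ of $X$, for every $y\in Y_+$ with $y\ne 0$ there is $x\in X$ with $0<i(x)\le y$. For $M\subseteq X$, $M^u$ is the set of upper bounds of $M$ in $X$. Elements $x,y\in X$ are disjoint, $x\perp y$, if $\{x+y,-x-y\}^u=\{x-y,-x+y\}^u$. The disjoint complement of $M\subseteq X$ is $M^{\mathrm{d}}=\{x\in X: x\perp y\text{ for all }y\in M\}$, and $M^{\mathrm{dd}}=(M^{\mathrm{d}})^{\mathrm{d}}$. A linear subspace $B$ is a band if $B^{\mathrm{dd}}=B$. A subset $M\subseteq X$ is solid if for all $x\in X$, $y\in M$ the inclusion $\{x,-x\}^u\supseteq\{y,-y\}^u$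 implies $x\in M$; an ideal is a solid linear subspace. $\mathcal I_a$ (resp. $\mathcal B_a$) is the intersection of all ideals (resp. bands) in $X$ containing $a$; one has $\mathcal B_a=\{a\}^{\mathrm{dd}}$. An element $a\in X_+\setminus\{0\}$ is an atom if $0\le x\le a$ implies $x=\lambda a$ for some real $\lambda\ge 0$. *)

theory Defs
  imports "HOL-Analysis.Analysis" "HOL-Library.Lub_Glb"
begin

text \<open>
  Ordered vector spaces are the types of class \<^class>\<open>ordered_real_vector\<close>, with cone
  \<open>{x. 0 \<le> x}\<close>; vector lattices are the types of sort \<open>{ordered_real_vector, lattice}\<close>.
\<close>

class archimedean_ordered_real_vector = ordered_real_vector +
  assumes archimedean: "(\<And>n::nat. real n *\<^sub>R x \<le> y) \<Longrightarrow> x \<le> 0"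

definition order_dense :: "'b::ordered_real_vector set \<Rightarrow> bool" where
  "order_dense D \<longleftrightarrow> subspace D \<and> (\<forall>y. isGlb UNIV {z \<in> D. y \<le> z} y)"

definition bipositive :: "('a::ordered_real_vector \<Rightarrow> 'b::ordered_real_vector) \<Rightarrow> bool" where
  "bipositive i \<longleftrightarrow> (\<forall>x. 0 \<le> i x \<longleftrightarrow> 0 \<le> x)"

text \<open>
  The domain type of \<open>i\<close> is a pre-Riesz space iff some \<open>i\<close> into some vector lattice is a
  vector lattice cover. HOL cannot quantify over the codomain type inside a formula, so a theorem
  about a pre-Riesz space takes a cover \<open>i\<close>, with a codomain of arbitrary type, as a hypothesis.
\<close>

definition vector_lattice_cover ::
    "('a::ordered_real_vector \<Rightarrow> 'b::{ordered_real_vector, lattice}) \<Rightarrow> bool" where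
  "vector_lattice_cover i \<longleftrightarrow> linear i \<and> bipositive i \<and> order_dense (range i)"

text \<open>
  The condition for the domain of a vector lattice cover \<open>i\<close> to be pervasive, stated for
  the given cover; a pre-Riesz space is pervasive iff it holds for some cover.
\<close>

definition pervasive_in ::
    "('a::ordered_real_vector \<Rightarrow> 'b::{ordered_real_vector, lattice}) \<Rightarrow> bool" where
  "pervasive_in i \<longleftrightarrow> (\<forall>y. 0 \<le> y \<and> y \<noteq> 0 \<longrightarrow> (\<exists>x. 0 < i x \<and> i x \<le> y))"

definition perp :: "'a::ordered_real_vector \<Rightarrow> 'a \<Rightarrow> bool"  (infix "\<bottom>" 50) where
  "x \<bottom> y \<longleftrightarrow> ubs UNIV {x + y, - x - y} = ubs UNIV {x - y, - x + y}"

definition disjoint_complement :: "'a::ordered_real_vector set \<Rightarrow> 'a set" where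
  "disjoint_complement M = {x. \<forall>y\<in>M. x \<bottom> y}"

definition band :: "'a::ordered_real_vector set \<Rightarrow> bool" where
  "band B \<longleftrightarrow> subspace B \<and> disjoint_complement (disjoint_complement B) = B"

definition solid :: "'a::ordered_real_vector set \<Rightarrow> bool" where
  "solid M \<longleftrightarrow> (\<forall>x. \<forall>y\<in>M. ubs UNIV {y, - y} \<subseteq> ubs UNIV {x, - x} \<longrightarrow> x \<in> M)"

definition order_ideal :: "'a::ordered_real_vector set \<Rightarrow> bool" where
  "order_ideal I \<longleftrightarrow> subspace I \<and> solid I"

definition principal_ideal :: "'a::ordered_real_vector \<Rightarrow> 'a set" where
  "principal_ideal a = \<Inter>{I. order_ideal I \<and> a \<in> I}"

definition principal_band :: "'a::ordered_real_vector \<Rightarrow> 'a set" where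
  "principal_band a = \<Inter>{B. band B \<and> a \<in> B}"

definition order_atom :: "'a::ordered_real_vector \<Rightarrow> bool" where
  "order_atom a \<longleftrightarrow> 0 \<le> a \<and> a \<noteq> 0 \<and> (\<forall>x. 0 \<le> x \<and> x \<le> a \<longrightarrow> (\<exists>r::real. 0 \<le> r \<and> x = r *\<^sub>R a))"

end

theory Submission
  imports Defs
begin

text \<open>
  Both sides equal the line \<open>span {a}\<close>. Every ideal and every band containing \<open>a\<close>
  contains this line, so it suffices that the line is itself an ideal and a band. It is
  an ideal because an element between \<open>- s a\<close> and \<open>s a\<close> is a multiple of \<open>a\<close>
  (\<open>order_ideal_span_atom\<close>).

  For the band property, let \<open>i: X \<rightarrow> Y\<close> be the vector lattice cover. Since \<open>X\<close> is
  Archimedean and pervasive, \<open>Y\<close> is Archimedean too, and \<open>e = i a\<close> is an atom of \<open>Y\<close>.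
  Let \<open>x\<close> lie in the double disjoint complement of the line and let \<open>u = i x\<close>. By the
  Archimedean property there is a largest \<open>l\<close> with \<open>l e \<le> u\<^sup>+\<close>. If
  \<open>w = u\<^sup>+ - l e\<close> were not zero, then \<open>0 < i z \<le> w\<close> for some \<open>z\<close> in \<open>X\<close>. As
  \<open>l\<close> is maximal and \<open>e\<close> is an atom, \<open>z\<close> is disjoint from \<open>a\<close>, hence from \<open>x\<close>; but
  \<open>i z \<le> u\<^sup>+\<close> makes this impossible. So \<open>u\<^sup>+\<close> and likewise \<open>u\<^sup>-\<close> are multiples of
  \<open>e\<close>, and so is \<open>u\<close> (\<open>disjoint_complement_span_atom\<close>).
\<close>

section \<open>Disjointness and atoms in an ordered vector space\<close>

lemma mem_ubs_pair: "b \<in> ubs UNIV {x, y} \<longleftrightarrow> x \<le> b \<and> y \<le> b"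
  by (simp add: ubs_def isUb_def setle_def)

lemma perp_commute: "x \<bottom> y \<longleftrightarrow> y \<bottom> x"
proof -
  have "{y + x, - y - x} = {x + y, - x - y}" "{y - x, - y + x} = {x - y, - x + y}"
    by (auto simp: algebra_simps)
  then show ?thesis by (simp only: perp_def)
qed

lemma perp_minus_right: "x \<bottom> - y \<longleftrightarrow> x \<bottom> y"
  by (auto simp: perp_def)

lemma order_atom_multiple:
  assumes "order_atom a" and "0 \<le> s" and "0 \<le> x" and "x \<le> s *\<^sub>R a"
  shows "\<exists>r\<ge>0. x = r *\<^sub>R a"
proof (cases "s = 0")
  case True
  then show ?thesis using assms by (intro exI[of _ 0]) auto
next
  case False
  then have s: "s > 0" using assms by simp
  have "0 \<le> inverse s *\<^sub>R x" using s assms by (simp add: scaleR_nonneg_nonneg)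
  moreover have "inverse s *\<^sub>R x \<le> a"
    using scaleR_left_mono[OF assms(4), of "inverse s"] s by simp
  ultimately obtain r where "0 \<le> r" "inverse s *\<^sub>R x = r *\<^sub>R a"
    using assms(1) unfolding order_atom_def by blast
  then have "s *\<^sub>R (inverse s *\<^sub>R x) = s *\<^sub>R (r *\<^sub>R a)" by simp
  then have "x = (s * r) *\<^sub>R a" using s by simp
  then show ?thesis using s \<open>0 \<le> r\<close> by (intro exI[of _ "s * r"]) auto
qed

lemma order_ideal_span_atom:
  assumes "order_atom a"
  shows "order_ideal (span {a})"
proof -
  have a: "0 \<le> a" using assms by (simp add: order_atom_def)
  have "x \<in> span {a}" if y: "y \<in> span {a}" and sub: "ubs UNIV {y, - y} \<subseteq> ubs UNIV {x, - x}" for x y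
  proof -
    obtain s where s: "y = s *\<^sub>R a" using y by (auto simp: span_singleton)
    have "s *\<^sub>R a \<le> \<bar>s\<bar> *\<^sub>R a" "(- s) *\<^sub>R a \<le> \<bar>s\<bar> *\<^sub>R a"
      using a by (intro scaleR_right_mono; simp)+
    then have "\<bar>s\<bar> *\<^sub>R a \<in> ubs UNIV {y, - y}" by (simp add: mem_ubs_pair s)
    then have *: "x \<le> \<bar>s\<bar> *\<^sub>R a" "- x \<le> \<bar>s\<bar> *\<^sub>R a"
      using sub mem_ubs_pair by blast+
    have "0 \<le> x + \<bar>s\<bar> *\<^sub>R a" using add_left_mono[OF *(2), of x] by simp
    moreover have "x + \<bar>s\<bar> *\<^sub>R a \<le> (2 * \<bar>s\<bar>) *\<^sub>R a"
      using add_right_mono[OF *(1), of "\<bar>s\<bar> *\<^sub>R a"] by (simp add: scaleR_left_distrib[symmetric])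
    ultimately obtain r where "x + \<bar>s\<bar> *\<^sub>R a = r *\<^sub>R a"
      using order_atom_multiple[OF assms, of "2 * \<bar>s\<bar>"] by auto
    then have "x = (r - \<bar>s\<bar>) *\<^sub>R a" by (simp add: algebra_simps)
    then show ?thesis by (simp add: span_mul span_base)
  qed
  then show ?thesis by (auto simp: order_ideal_def solid_def)
qed

text \<open>
  In an ordered vector space whose order is Archimedean, a positive element has a largest
  multiple below a given positive element.
\<close>

lemma largest_multiple_below:
  fixes e y :: "'b::ordered_real_vector"
  assumes arch: "\<forall>x z :: 'b. (\<forall>n::nat. real n *\<^sub>R x \<le> z) \<longrightarrow> x \<le> 0"
    and e: "0 \<le> e" "e \<noteq> 0" and y: "0 \<le> y"
  shows "\<exists>l. l *\<^sub>R e \<le> y \<and> (\<forall>r. r *\<^sub>R e \<le> y \<longrightarrow> r \<le> l)"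
proof -
  let ?S = "{r. r *\<^sub>R e \<le> y}"
  have down: "s *\<^sub>R e \<le> y" if "r *\<^sub>R e \<le> y" "s \<le> r" for r s
    using that e scaleR_right_mono order_trans by metis
  have ne: "?S \<noteq> {}" using y by (auto intro!: exI[of _ 0])
  have bdd: "bdd_above ?S"
  proof (rule ccontr)
    assume nb: "\<not> bdd_above ?S"
    have "real n *\<^sub>R e \<le> y" for n
    proof -
      obtain r where "r \<in> ?S" "real n < r" using nb by (force simp: bdd_above_def not_le)
      then show ?thesis using down by auto
    qed
    then show False using arch e by (metis order_antisym)
  qed
  define l where "l = Sup ?S"
  have "real n *\<^sub>R (l *\<^sub>R e - y) \<le> e" for n
  proof (cases "n = 0")
    case True then show ?thesis using e by simp
  next
    case False
    then have "l - inverse (real n) < Sup ?S" by (simp add: l_def)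
    then obtain r where "r \<in> ?S" "l - inverse (real n) < r"
      using less_cSupD[OF ne] by blast
    then have "(l - inverse (real n)) *\<^sub>R e \<le> y" using down by auto
    then have "l *\<^sub>R e - y \<le> inverse (real n) *\<^sub>R e" by (simp add: algebra_simps)
    then have "real n *\<^sub>R (l *\<^sub>R e - y) \<le> real n *\<^sub>R (inverse (real n) *\<^sub>R e)"
      by (rule scaleR_left_mono) simp
    then show ?thesis using False by simp
  qed
  then have "l *\<^sub>R e - y \<le> 0" using arch by blast
  then show ?thesis using cSup_upper[OF _ bdd] by (auto simp: l_def intro!: exI[of _ "Sup ?S"])
qed

section \<open>Disjointness through a vector lattice cover\<close>

context
  fixes i :: "'a::archimedean_ordered_real_vector \<Rightarrow> 'b::{ordered_real_vector, lattice}"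
  assumes cover: "vector_lattice_cover i"
begin

lemma cover_linear: "linear i"
  using cover by (simp add: vector_lattice_cover_def)

lemma cover_le_iff: "i x \<le> i y \<longleftrightarrow> x \<le> y"
proof -
  have "i x \<le> i y \<longleftrightarrow> 0 \<le> i (y - x)" by (simp add: linear_diff[OF cover_linear])
  then show ?thesis using cover by (simp add: vector_lattice_cover_def bipositive_def)
qed

lemma cover_eq_iff: "i x = i y \<longleftrightarrow> x = y"
  by (metis cover_le_iff order_antisym order_refl)

text \<open>
  An element of \<open>Y\<close> is determined by its upper bounds in the image of \<open>X\<close>; this transfers
  \<^const>\<open>perp\<close>, a condition on upper bounds in \<open>X\<close>, to inequalities in \<open>Y\<close>.
\<close>

lemma le_by_order_density:
  assumes "\<And>z. y \<le> i z \<Longrightarrow> t \<le> i z"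
  shows "t \<le> y"
proof -
  have "isGlb UNIV {z \<in> range i. y \<le> z} y"
    using cover by (simp add: vector_lattice_cover_def order_dense_def)
  then show ?thesis using assms
    by (auto simp: isGlb_def greatestP_def isLb_def setle_def setge_def)
qed

lemma cover_majorizing: "\<exists>w. y \<le> i w"
proof (rule ccontr)
  assume none: "\<nexists>w. y \<le> i w"
  \<comment> \<open>The infimum of the empty set is a greatest element, which forces \<open>y \<le> 0\<close>.\<close>
  have "y + y \<le> y" by (rule le_by_order_density) (use none in blast)
  then have "y \<le> i 0" by (simp add: linear_0[OF cover_linear])
  then show False using none by blast
qed

text \<open>
  In \<open>Y\<close>, disjointness of \<open>x\<close> and \<open>z\<close> says \<open>\<bar>u + v\<bar> = \<bar>u - v\<bar>\<close> for \<open>u = i x\<close> and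
  \<open>v = i z\<close>. When \<open>0 \<le> v \<le> u\<^sup>+\<close> the right side is \<open>\<bar>u\<bar> - v\<close>, which gives
  \<open>v \<le> u\<^sup>-\<close> as well, so \<open>v\<close> is below the infimum of \<open>u\<^sup>+\<close> and \<open>u\<^sup>-\<close>, which is zero.
\<close>

lemma perp_below_positive_part:
  assumes "x \<bottom> z" and v0: "0 \<le> i z" and vp: "i z \<le> sup (i x) 0"
  shows "i z = 0"
proof -
  define u v p where "u = i x" and "v = i z" and "p = sup (i x) 0"
  have p: "u \<le> p" "0 \<le> p" "v \<le> p" and v: "0 \<le> v"
    using vp v0 by (simp_all add: u_def v_def p_def)
  \<comment> \<open>\<open>p + (p - u)\<close> is \<open>u\<^sup>+ + u\<^sup>- = \<bar>u\<bar>\<close>.\<close>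
  define b where "b = p + (p - u) - v"
  have b1: "u - v \<le> b" using add_mono[OF p(1) p(1)] by (simp add: b_def algebra_simps)
  have b2: "v - u \<le> b" using add_mono[OF p(3) p(3)] by (simp add: b_def algebra_simps)
  have "u + v \<le> b"
  proof (rule le_by_order_density)
    fix c assume "b \<le> i c"
    then have "u - v \<le> i c" "v - u \<le> i c" using b1 b2 by auto
    then have "i (x - z) \<le> i c" "i (- x + z) \<le> i c"
      by (simp_all add: u_def v_def linear_diff[OF cover_linear] linear_add[OF cover_linear]
          linear_neg[OF cover_linear])
    then have "c \<in> ubs UNIV {x - z, - x + z}" by (simp add: mem_ubs_pair cover_le_iff)
    then have "c \<in> ubs UNIV {x + z, - x - z}" using assms(1) by (simp add: perp_def)
    then have "i (x + z) \<le> i c" by (simp add: mem_ubs_pair cover_le_iff)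
    then show "u + v \<le> i c" by (simp add: u_def v_def linear_add[OF cover_linear])
  qed
  then have "2 *\<^sub>R v \<le> 2 *\<^sub>R (p - u)" by (simp add: b_def algebra_simps scaleR_2)
  then have "v \<le> p - u" by (simp add: scaleR_le_cancel_left_pos)
  then have "u \<le> p - v" by (simp add: algebra_simps)
  moreover have "0 \<le> p - v" using p by simp
  ultimately have "p \<le> p - v" by (simp add: p_def u_def)
  then have "v \<le> 0" by simp
  then show ?thesis using v by (simp add: v_def)
qed

text \<open>
  For positive \<open>f = i q\<close> and \<open>v = i z\<close> with infimum zero, stated as a condition on lower
  bounds, both \<open>\<bar>f + v\<bar>\<close> and \<open>\<bar>f - v\<bar>\<close> equal \<open>f + v\<close>.
\<close>

lemma perp_if_lower_bounds_nonpos: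
  assumes "0 \<le> q" "0 \<le> z" and inf0: "\<And>c. c \<le> i q \<Longrightarrow> c \<le> i z \<Longrightarrow> c \<le> 0"
  shows "z \<bottom> q"
proof -
  have "z + q \<le> b \<and> - z - q \<le> b \<longleftrightarrow> z - q \<le> b \<and> - z + q \<le> b" for b
  proof
    assume *: "z + q \<le> b \<and> - z - q \<le> b"
    have "z - q \<le> z + q" "- z + q \<le> z + q"
      using add_mono[OF assms(1) assms(1)] add_mono[OF assms(2) assms(2)]
      by (simp_all add: algebra_simps add_increasing)
    then show "z - q \<le> b \<and> - z + q \<le> b" using * order_trans by blast
  next
    assume *: "z - q \<le> b \<and> - z + q \<le> b"
    \<comment> \<open>The two bounds say exactly that \<open>c\<close> is below both \<open>q\<close> and \<open>z\<close>, while
      \<open>c \<le> 0\<close> is the claim \<open>z + q \<le> b\<close>.\<close>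
    define c where "c = (1/2::real) *\<^sub>R (z + q - b)"
    have "2 *\<^sub>R c \<le> 2 *\<^sub>R q" "2 *\<^sub>R c \<le> 2 *\<^sub>R z"
      using * by (simp_all add: c_def scaleR_2 algebra_simps)
    then have "c \<le> q" "c \<le> z" by (simp_all add: scaleR_le_cancel_left_pos)
    then have "i c \<le> i 0" using inf0[of "i c"] by (simp add: cover_le_iff linear_0[OF cover_linear])
    then have "2 *\<^sub>R c \<le> 2 *\<^sub>R 0" by (simp add: cover_le_iff scaleR_nonneg_nonpos)
    then have le: "z + q \<le> b" by (simp add: c_def)
    have "- z - q \<le> z + q" using assms add_nonneg_nonneg[OF assms(2,1)]
      by (metis minus_add_distrib neg_le_0_iff_le order_trans uminus_add_conv_diff add.commute)
    then show "z + q \<le> b \<and> - z - q \<le> b" using le by auto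
  qed
  then show ?thesis by (auto simp: perp_def mem_ubs_pair)
qed

section \<open>Pervasiveness and the band of an atom\<close>

context
  assumes perv: "pervasive_in i"
begin

lemma element_below_gap:
  assumes "s \<le> t" and "t - s \<noteq> 0"
  shows "\<exists>x. 0 < i x \<and> i x \<le> t - s"
proof -
  have "0 \<le> t - s" using assms(1) by simp
  then show ?thesis using perv assms(2) unfolding pervasive_in_def by blast
qed

text \<open>
  If \<open>n x \<le> z\<close> for all \<open>n\<close> but \<open>x\<^sup>+ \<noteq> 0\<close>, then a positive element \<open>t\<close> of \<open>X\<close> below
  \<open>x\<^sup>+\<close> and an element of \<open>X\<close> above \<open>z\<^sup>+\<close> contradict the Archimedean property of \<open>X\<close>.
\<close>

lemma cover_archimedean:
  fixes x z :: 'b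
  assumes "\<And>n::nat. real n *\<^sub>R x \<le> z"
  shows "x \<le> 0"
proof (rule ccontr)
  assume "\<not> x \<le> 0"
  then have "sup x 0 \<noteq> 0" by (metis sup_ge1)
  then obtain t where t: "0 < i t" "i t \<le> sup x 0"
    using perv by (metis pervasive_in_def sup_ge2)
  obtain w where w: "sup z 0 \<le> i w" using cover_majorizing by blast
  have "real n *\<^sub>R t \<le> w" for n
  proof (cases "n = 0")
    case True
    have "i 0 \<le> i w" using w by (simp add: linear_0[OF cover_linear])
    then show ?thesis using True by (simp add: cover_le_iff)
  next
    case False
    have "inverse (real n) *\<^sub>R (real n *\<^sub>R x) \<le> inverse (real n) *\<^sub>R sup z 0"
      by (rule scaleR_left_mono) (use assms[of n] in \<open>auto intro: le_supI1\<close>)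
    then have "x \<le> inverse (real n) *\<^sub>R sup z 0" using False by simp
    then have "i t \<le> inverse (real n) *\<^sub>R sup z 0"
      using t by (meson order_trans sup_least scaleR_nonneg_nonneg sup_ge2
          inverse_nonnegative_iff_nonnegative of_nat_0_le_iff)
    then have "real n *\<^sub>R i t \<le> real n *\<^sub>R (inverse (real n) *\<^sub>R sup z 0)"
      by (rule scaleR_left_mono) simp
    then have "i (real n *\<^sub>R t) \<le> i w"
      using False order_trans[OF _ w] by (simp add: linear_scale[OF cover_linear])
    then show ?thesis by (simp add: cover_le_iff)
  qed
  then have "t \<le> 0" by (rule archimedean)
  then have "i t \<le> 0" using cover_le_iff[of t 0] by (simp add: linear_0[OF cover_linear])
  then show False using t by simp
qed

text \<open>
  Subtract from \<open>y \<le> i a\<close> its largest multiple of \<open>i a\<close>. If the rest were not zero, an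
  element of \<open>X\<close> below it would lie below \<open>a\<close>, hence be a further multiple of \<open>a\<close>.
\<close>

lemma cover_order_atom:
  assumes a: "order_atom a"
  shows "order_atom (i a)"
proof -
  have arch: "\<forall>x z :: 'b. (\<forall>n::nat. real n *\<^sub>R x \<le> z) \<longrightarrow> x \<le> 0"
    using cover_archimedean by blast
  have a0: "0 \<le> i a" "i a \<noteq> 0"
    using a cover_le_iff[of 0 a] cover_eq_iff[of a 0]
    by (simp_all add: order_atom_def linear_0[OF cover_linear])
  have "\<exists>r\<ge>0. y = r *\<^sub>R i a" if y: "0 \<le> y" "y \<le> i a" for y
  proof -
    obtain l where l: "l *\<^sub>R i a \<le> y" "\<And>r. r *\<^sub>R i a \<le> y \<Longrightarrow> r \<le> l"
      using largest_multiple_below[OF arch a0 y(1)] by blast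
    have l0: "0 \<le> l" using l(2)[of 0] y by simp
    have "y - l *\<^sub>R i a = 0"
    proof (rule ccontr)
      assume "y - l *\<^sub>R i a \<noteq> 0"
      then obtain x where x: "0 < i x" "i x \<le> y - l *\<^sub>R i a"
        using element_below_gap[OF l(1)] by auto
      have "i x \<le> y" using x(2) l0 a0 by (metis diff_ge_0_iff_ge diff_le_eq order_trans
            le_add_same_cancel1 scaleR_nonneg_nonneg)
      then have "i x \<le> i a" using y by simp
      then have "0 \<le> x" "x \<le> a" using less_imp_le[OF x(1)] cover_le_iff[of 0 x]
        by (simp_all add: cover_le_iff linear_0[OF cover_linear])
      then obtain r where r: "0 \<le> r" "x = r *\<^sub>R a"
        using a unfolding order_atom_def by blast
      then have "(l + r) *\<^sub>R i a \<le> y"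
        using x by (simp add: linear_scale[OF cover_linear] algebra_simps)
      then have "r = 0" using l(2) r(1) by force
      then show False using x r by (simp add: linear_0[OF cover_linear])
    qed
    then show ?thesis using l0 by auto
  qed
  then show ?thesis using a0 by (auto simp: order_atom_def)
qed

text \<open>
  Membership of \<open>x\<close> in the double disjoint complement enters here: a positive element
  disjoint from the atom is disjoint from \<open>x\<close>, so its image is not below the positive part of
  \<open>i x\<close> unless it is zero.
\<close>

lemma positive_part_multiple_of_atom:
  assumes a: "order_atom a"
    and x: "x \<in> disjoint_complement (disjoint_complement (span {a}))"
  shows "\<exists>l. sup (i x) 0 = l *\<^sub>R i a"
proof -
  have arch: "\<forall>x z :: 'b. (\<forall>n::nat. real n *\<^sub>R x \<le> z) \<longrightarrow> x \<le> 0"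
    using cover_archimedean by blast
  have atom: "order_atom (i a)" using cover_order_atom[OF a] .
  then have a0: "0 \<le> i a" "i a \<noteq> 0" by (simp_all add: order_atom_def)
  obtain l where l: "l *\<^sub>R i a \<le> sup (i x) 0"
      "\<And>r. r *\<^sub>R i a \<le> sup (i x) 0 \<Longrightarrow> r \<le> l"
    using largest_multiple_below[OF arch a0, where y = "sup (i x) 0"] by auto
  have l0: "0 \<le> l" using l(2)[of 0] by simp
  have "sup (i x) 0 - l *\<^sub>R i a = 0"
  proof (rule ccontr)
    assume "sup (i x) 0 - l *\<^sub>R i a \<noteq> 0"
    then obtain z where z: "0 < i z" "i z \<le> sup (i x) 0 - l *\<^sub>R i a"
      using element_below_gap[OF l(1)] by auto
    have z0: "0 \<le> z" using less_imp_le[OF z(1)] cover_le_iff[of 0 z]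
      by (simp add: linear_0[OF cover_linear])
    have zp: "z \<bottom> s *\<^sub>R a" if s: "0 \<le> s" for s
    proof (rule perp_if_lower_bounds_nonpos)
      show "0 \<le> s *\<^sub>R a" using s a by (simp add: order_atom_def scaleR_nonneg_nonneg)
      show "0 \<le> z" by (fact z0)
      fix c assume c: "c \<le> i (s *\<^sub>R a)" "c \<le> i z"
      have "sup c 0 \<le> s *\<^sub>R i a"
        using c s a0 by (simp add: linear_scale[OF cover_linear] scaleR_nonneg_nonneg)
      then obtain t where t: "0 \<le> t" "sup c 0 = t *\<^sub>R i a"
        using order_atom_multiple[OF atom s, of "sup c 0"] by auto
      have "sup c 0 \<le> i z" using c z by simp
      then have "t *\<^sub>R i a \<le> sup (i x) 0 - l *\<^sub>R i a" using z t by simp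
      then have "(l + t) *\<^sub>R i a \<le> sup (i x) 0" by (simp add: algebra_simps)
      then have "t = 0" using l(2) t(1) by force
      then show "c \<le> 0" using t by (metis scaleR_zero_left sup_ge1)
    qed
    have "z \<bottom> s *\<^sub>R a" for s
      using zp[of s] zp[of "- s"] perp_minus_right[of z "s *\<^sub>R a"] by (cases "0 \<le> s") auto
    then have "z \<in> disjoint_complement (span {a})"
      by (auto simp: disjoint_complement_def span_singleton)
    then have "x \<bottom> z" using x by (simp add: disjoint_complement_def)
    moreover have "i z \<le> sup (i x) 0"
      using z(2) l0 a0 by (metis diff_le_eq order_trans le_add_same_cancel1 scaleR_nonneg_nonneg
          diff_ge_0_iff_ge)
    ultimately show False using perp_below_positive_part[of x z] less_imp_le[OF z(1)] z(1) by simp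
  qed
  then show ?thesis by auto
qed

lemma disjoint_complement_span_atom:
  fixes a :: 'a
  assumes a: "order_atom a"
  shows "disjoint_complement (disjoint_complement (span {a})) = span {a}"
proof
  show "span {a} \<subseteq> disjoint_complement (disjoint_complement (span {a}))"
    by (auto simp: disjoint_complement_def perp_commute)
  show "disjoint_complement (disjoint_complement (span {a})) \<subseteq> span {a}"
  proof
    fix x assume x: "x \<in> disjoint_complement (disjoint_complement (span {a}))"
    then have "- x \<in> disjoint_complement (disjoint_complement (span {a}))"
      by (auto simp: disjoint_complement_def perp_commute[of "- x"] perp_commute[of x]
          perp_minus_right)
    then obtain l m where l: "sup (i x) 0 = l *\<^sub>R i a" and m: "sup (i (- x)) 0 = m *\<^sub>R i a"
      using positive_part_multiple_of_atom[OF a] x by meson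
    have "sup (i x) 0 = i x + sup (- i x) 0"
    proof (rule order_antisym)
      have "- i x \<le> sup (i x) 0 - i x" "0 \<le> sup (i x) 0 - i x" by simp_all
      then have "sup (- i x) 0 \<le> sup (i x) 0 - i x" by simp
      then show "i x + sup (- i x) 0 \<le> sup (i x) 0" by (simp add: algebra_simps)
      have "0 \<le> i x + sup (- i x) 0" using add_left_mono[of "- i x" "sup (- i x) 0" "i x"] by simp
      then show "sup (i x) 0 \<le> i x + sup (- i x) 0" by simp
    qed
    then have "i x = i ((l - m) *\<^sub>R a)"
      using l m by (simp add: linear_scale[OF cover_linear] linear_neg[OF cover_linear]
          scaleR_left_diff_distrib linear_diff[OF cover_linear] eq_diff_eq)
    then have "x = (l - m) *\<^sub>R a" by (simp only: cover_eq_iff)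
    then show "x \<in> span {a}" by (simp add: span_mul span_base)
  qed
qed

end

end

section \<open>Principal ideal and principal band\<close>

theorem theorem42:
  fixes i :: "'a::archimedean_ordered_real_vector \<Rightarrow> 'b::{ordered_real_vector, lattice}"
    and a :: 'a
  assumes "vector_lattice_cover i" and "pervasive_in i"
    and "order_atom a"
  shows "principal_ideal a = principal_band a"
proof -
  have sub: "span {a} \<subseteq> S" if "subspace S" "a \<in> S" for S
    using that by (simp add: span_minimal)
  have "band (span {a})"
    using disjoint_complement_span_atom[OF assms] by (simp add: band_def)
  then have "principal_band a = span {a}"
    using sub by (auto simp: principal_band_def band_def span_base)
  moreover have "principal_ideal a = span {a}"
    using order_ideal_span_atom[OF assms(3)] sub
    by (auto simp: principal_ideal_def order_ideal_def span_base)
  ultimately show ?thesis by simp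
qed

end
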